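(* Let $X_1,\ldots,X_n$ be independent real-valued random variables and let $g_i:\mathbb{R}\to\mathbb{R}$, $i=1,2,\ldots,n$, be decreasing functions. Set $Y_1=g_1(X_1),\ldots,Y_n=g_n(X_n)$. Let $A_1,\ldots,A_m$ be (pairwise) disjoint subsets of $\{1,2,\ldots,n\}$, and let $B_1,\ldots,B_m$ be (pairwise) disjoint subsets of $\{1,2,\ldots,n\}$. For $j=1,\ldots,m$ set $$S_j=f_j\left(\{X_i: i\in A_j\},\{Y_i: i\in B_j\}\right),$$ where each $f_j$ is a real-valued, coordinate-wise increasing function of $|A_j|+|B_j|$ variables. Then the random variables $S_1,\ldots,S_m$ are negatively associated.
   Context: Throughout, increasing (decreasing) means nondecreasing (nonincreasing). Random variables $S_1,\ldots,S_m$ are said to be negatively associated (NA) if for every pair of disjoint subsets $A, A'$ of $\{1,\ldots,m\}$, $$\mathrm{Cov}\left(f(S_i, i\in A),\, f'(S_j, j\in A')\right)\leq 0$$ whenever $f$ and $f'$ are real-valued functions, increasing in all coordinates, for which the covariance exists. *)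

theory Defs
  imports "HOL-Probability.Probability"
begin

(* Functions of the variables (x_i, i in I) are functions on the space of PiM I (\<lambda>_. borel).
   As usual in probability, they are taken to be Borel measurable. This is not automatic: an
   increasing function of two or more real variables need not be Borel. *)
definition coordwise_increasing :: "'i set \<Rightarrow> (('i \<Rightarrow> real) \<Rightarrow> real) \<Rightarrow> bool" where
  "coordwise_increasing I f \<longleftrightarrow>
     (\<forall>x \<in> (\<Pi>\<^sub>E i\<in>I. UNIV). \<forall>i\<in>I. mono (\<lambda>t. f (x(i := t))))"

definition covariance :: "'a measure \<Rightarrow> ('a \<Rightarrow> real) \<Rightarrow> ('a \<Rightarrow> real) \<Rightarrow> real" where
  "covariance M U V =
     (LINT \<omega>|M. (U \<omega> - (LINT \<xi>|M. U \<xi>)) * (V \<omega> - (LINT \<xi>|M. V \<xi>)))"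

(* Only first moments and the mixed moment are required, not second moments. *)
definition covariance_exists :: "'a measure \<Rightarrow> ('a \<Rightarrow> real) \<Rightarrow> ('a \<Rightarrow> real) \<Rightarrow> bool" where
  "covariance_exists M U V \<longleftrightarrow>
     integrable M U \<and> integrable M V \<and> integrable M (\<lambda>\<omega>. U \<omega> * V \<omega>)"

definition negatively_associated ::
    "'a measure \<Rightarrow> 'i set \<Rightarrow> ('i \<Rightarrow> 'a \<Rightarrow> real) \<Rightarrow> bool" where
  "negatively_associated M I S \<longleftrightarrow>
     (\<forall>i\<in>I. S i \<in> borel_measurable M) \<and>
     (\<forall>A A' f f'.
        A \<subseteq> I \<longrightarrow> A' \<subseteq> I \<longrightarrow> A \<inter> A' = {} \<longrightarrow>
        f \<in> borel_measurable (PiM A (\<lambda>_. borel)) \<longrightarrow> coordwise_increasing A f \<longrightarrow>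
        f' \<in> borel_measurable (PiM A' (\<lambda>_. borel)) \<longrightarrow> coordwise_increasing A' f' \<longrightarrow>
        covariance_exists M (\<lambda>\<omega>. f (\<lambda>i\<in>A. S i \<omega>)) (\<lambda>\<omega>. f' (\<lambda>i\<in>A'. S i \<omega>)) \<longrightarrow>
        covariance M (\<lambda>\<omega>. f (\<lambda>i\<in>A. S i \<omega>)) (\<lambda>\<omega>. f' (\<lambda>i\<in>A'. S i \<omega>)) \<le> 0)"

end

theory Submission
  imports Defs
begin

text \<open>
  The proof extends Chebyshev's association inequality to several independent coordinates. Let
  \<^term>\<open>U\<close> be an increasing function of the scores with index in one set, and \<^term>\<open>V\<close> an increasing
  function of the scores with index in a disjoint set, both read as functions of
  \<open>x = (x\<^sub>1, \<dots>, x\<^sub>n)\<close>. Growth of \<open>x\<^sub>i\<close> can push \<open>U\<close> or \<open>V\<close> upwards only through a block \<open>A\<^sub>j\<close>,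
  and downwards only through a block \<open>B\<^sub>j\<close>, because the \<open>g\<^sub>i\<close> are decreasing. Since the blocks
  \<open>A\<^sub>j\<close> are disjoint, at most one of \<open>U\<close>, \<open>V\<close> sees \<open>x\<^sub>i\<close> through such a block, so the other one is
  decreasing in \<open>x\<^sub>i\<close>; since the blocks \<open>B\<^sub>j\<close> are disjoint, likewise one of them is increasing
  in \<open>x\<^sub>i\<close>. In every case the increments of \<open>U\<close> and \<open>V\<close> in direction \<open>i\<close> never have the same strict
  sign, wherever the other coordinates are frozen: the two functions are countermonotone
  (\<open>countermonotone_in_scores\<close>).

  This relation survives the averaging of another coordinate over its distribution, so a negative
  correlation for one variable yields one for independent variables by induction on the set of
  coordinates (\<open>PiM_negative_correlation_bounded\<close>). The induction integrates freely and is
  therefore carried out for bounded functions; truncation, which preserves the relation, and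
  dominated convergence then give the case where only the two means and the mixed moment exist.
\<close>

section \<open>Countermonotone increments\<close>

text \<open>
  The frozen coordinates of \<open>U\<close> and of \<open>V\<close> are chosen separately. With a common point the relation
  would not pass to partial integrals, in which \<open>U\<close> and \<open>V\<close> are averaged independently of each
  other. The relation also covers a function that does not depend on the coordinate at all.
\<close>

definition countermonotone_in ::
    "('i \<Rightarrow> 'b measure) \<Rightarrow> 'i set \<Rightarrow> 'i \<Rightarrow> (('i \<Rightarrow> 'b) \<Rightarrow> real) \<Rightarrow> (('i \<Rightarrow> 'b) \<Rightarrow> real) \<Rightarrow> bool" where
  "countermonotone_in N I i U V \<longleftrightarrow>
     (\<forall>x\<in>space (PiM I N). \<forall>x'\<in>space (PiM I N). \<forall>s\<in>space (N i). \<forall>t\<in>space (N i).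
        (U (x(i:=s)) - U (x(i:=t))) * (V (x'(i:=s)) - V (x'(i:=t))) \<le> 0)"

lemma countermonotone_inD:
  assumes "countermonotone_in N I i U V" "x \<in> space (PiM I N)" "x' \<in> space (PiM I N)"
    "s \<in> space (N i)" "t \<in> space (N i)"
  shows "(U (x(i:=s)) - U (x(i:=t))) * (V (x'(i:=s)) - V (x'(i:=t))) \<le> 0"
  using assms unfolding countermonotone_in_def by blast

lemma countermonotone_in_mono_comp:
  assumes "mono p" "mono q" "countermonotone_in N I i U V"
  shows "countermonotone_in N I i (\<lambda>x. p (U x)) (\<lambda>x. q (V x))"
proof -
  have "(p a - p b) * (q c - q d) \<le> 0" if "(a - b) * (c - d) \<le> 0" for a b c d
  proof -
    from that have "(a \<ge> b \<and> c \<le> d) \<or> (a \<le> b \<and> c \<ge> d)"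
      by (auto simp: mult_le_0_iff)
    then show ?thesis
      using assms(1,2) by (auto simp: mult_le_0_iff dest: monoD)
  qed
  then show ?thesis
    using assms(3) unfolding countermonotone_in_def by blast
qed

text \<open>
  The product of the two expectations is the iterated average of \<open>a y * b z\<close> over independent
  \<open>y\<close> and \<open>z\<close>. With increments in the roles of \<^term>\<open>a\<close> and \<^term>\<open>b\<close>, this is the step that
  carries countermonotonicity over to partial averages.
\<close>

lemma (in prob_space) expectation_mult_nonpos:
  fixes a b :: "'a \<Rightarrow> real"
  assumes "integrable M a" "integrable M b"
    and "\<And>y z. y \<in> space M \<Longrightarrow> z \<in> space M \<Longrightarrow> a y * b z \<le> 0"
  shows "expectation a * expectation b \<le> 0"
proof -
  have "expectation a * b z \<le> 0" if "z \<in> space M" for z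
  proof -
    have "(\<integral>y. a y * b z \<partial>M) \<le> (\<integral>y. 0 \<partial>M)"
      using assms that by (intro integral_mono) auto
    then show ?thesis using assms by simp
  qed
  then have "(\<integral>z. expectation a * b z \<partial>M) \<le> (\<integral>z. 0 \<partial>M)"
    using assms by (intro integral_mono) auto
  then show ?thesis using assms by simp
qed

text \<open>
  Chebyshev's association inequality: averaging \<open>(u s - u t) * (v s - v t)\<close> over independent \<open>s\<close>
  and \<open>t\<close> gives twice the covariance of \<open>u\<close> and \<open>v\<close>.
\<close>

lemma (in prob_space) chebyshev_negative_correlation:
  fixes u v :: "'a \<Rightarrow> real"
  assumes [simp]: "integrable M u" "integrable M v" "integrable M (\<lambda>x. u x * v x)"
    and le: "\<And>s t. s \<in> space M \<Longrightarrow> t \<in> space M \<Longrightarrow> (u s - u t) * (v s - v t) \<le> 0"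
  shows "expectation (\<lambda>x. u x * v x) \<le> expectation u * expectation v"
proof -
  let ?c = "expectation (\<lambda>x. u x * v x)"
  have inner: "?c - expectation u * v t - u t * expectation v + u t * v t \<le> 0"
    if "t \<in> space M" for t
  proof -
    have "(\<integral>s. u s * v s - u s * v t - u t * v s + u t * v t \<partial>M) \<le> (\<integral>s. 0 \<partial>M)"
      using le that by (intro integral_mono) (auto simp: algebra_simps)
    then show ?thesis by (simp add: prob_space)
  qed
  have "(\<integral>t. ?c - expectation u * v t - u t * expectation v + u t * v t \<partial>M) \<le> (\<integral>t. 0 \<partial>M)"
    using inner by (intro integral_mono) auto
  then have "2 * ?c - 2 * (expectation u * expectation v) \<le> 0"
    by (simp add: prob_space)
  then show ?thesis by simp
qed

section \<open>Negative correlation under product measures\<close>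

lemma fun_upd_in_space_PiM:
  "x \<in> space (PiM I N) \<Longrightarrow> y \<in> space (N i) \<Longrightarrow> x(i:=y) \<in> space (PiM (insert i I) N)"
  by (auto simp: space_PiM PiE_def extensional_def)

lemma measurable_section:
  assumes "U \<in> borel_measurable (PiM (insert i I) N)" "x \<in> space (PiM I N)"
  shows "(\<lambda>y. U (x(i:=y))) \<in> borel_measurable (N i)"
proof -
  have "(\<lambda>y. (\<lambda>(f, y). f(i:=y)) (x, y)) \<in> measurable (N i) (PiM (insert i I) N)"
    by (rule measurable_compose[OF measurable_Pair1'[OF assms(2)] measurable_add_dim])
  then show ?thesis
    using measurable_compose[OF _ assms(1)] by simp
qed

lemma measurable_partial_expectation:
  fixes U :: "_ \<Rightarrow> real"
  assumes "prob_space (N i)" "U \<in> borel_measurable (PiM (insert i I) N)"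
  shows "(\<lambda>x. \<integral>y. U (x(i:=y)) \<partial>N i) \<in> borel_measurable (PiM I N)"
proof -
  interpret prob_space "N i" by fact
  have "(\<lambda>p. U ((\<lambda>(f, y). f(i:=y)) p)) \<in> borel_measurable (PiM I N \<Otimes>\<^sub>M N i)"
    by (rule measurable_compose[OF measurable_add_dim assms(2)])
  then show ?thesis
    by (intro borel_measurable_lebesgue_integral) (simp add: case_prod_beta')
qed

lemma (in prob_space) integrable_of_bounded:
  fixes u :: "'a \<Rightarrow> real"
  assumes "u \<in> borel_measurable M" "\<And>x. x \<in> space M \<Longrightarrow> \<bar>u x\<bar> \<le> c"
  shows "integrable M u"
  using assms by (intro integrable_const_bound[where B = c]) auto

lemma (in prob_space) abs_expectation_le:
  fixes u :: "'a \<Rightarrow> real"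
  assumes "u \<in> borel_measurable M" "\<And>x. x \<in> space M \<Longrightarrow> \<bar>u x\<bar> \<le> c"
  shows "\<bar>expectation u\<bar> \<le> c"
proof -
  have "integrable M u"
    using assms by (rule integrable_of_bounded)
  then have "expectation u \<in> {-c..c}"
    using assms(2) by (auto intro!: integral_le_const integral_ge_const simp: abs_le_iff minus_le_iff)
  then show ?thesis by auto
qed

text \<open>
  Fubini reduces the mixed moment over \<^term>\<open>insert i I\<close> to the moment of the sections in direction
  \<^term>\<open>i\<close>. The one-dimensional inequality bounds it by the product of the two partial averages, and
  these are again countermonotone in the remaining coordinates.
\<close>

lemma PiM_negative_correlation_bounded:
  fixes U V :: "('i \<Rightarrow> 'b) \<Rightarrow> real"
  assumes prob: "\<And>i. prob_space (N i)" and "finite I"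
    and "U \<in> borel_measurable (PiM I N)" "V \<in> borel_measurable (PiM I N)"
    and "\<And>x. x \<in> space (PiM I N) \<Longrightarrow> \<bar>U x\<bar> \<le> c" "\<And>x. x \<in> space (PiM I N) \<Longrightarrow> \<bar>V x\<bar> \<le> c"
    and "\<And>i. i \<in> I \<Longrightarrow> countermonotone_in N I i U V"
  shows "(\<integral>x. U x * V x \<partial>PiM I N) \<le> (\<integral>x. U x \<partial>PiM I N) * (\<integral>x. V x \<partial>PiM I N)"
  using assms(2-)
proof (induction I arbitrary: U V rule: finite_induct)
  case empty
  show ?case
    by (simp add: PiM_empty lebesgue_integral_count_space_finite)
next
  case (insert i I)
  interpret product_prob_space N I
    using prob by (rule product_prob_spaceI)
  interpret J: product_prob_space N "insert i I"
    using prob by (rule product_prob_spaceI)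
  note [measurable] = insert.prems(1,2)
  note bd = insert.prems(3,4)
  have c: "0 \<le> c"
    using bd(1) J.P.not_empty by (meson abs_ge_zero ex_in_conv order_trans)
  have bdm: "\<bar>U x * V x\<bar> \<le> c * c" if "x \<in> space (PiM (insert i I) N)" for x
    using bd[OF that] c by (simp add: abs_mult mult_mono)
  have int: "integrable (PiM (insert i I) N) U" "integrable (PiM (insert i I) N) V"
    "integrable (PiM (insert i I) N) (\<lambda>x. U x * V x)"
    by (rule J.P.integrable_of_bounded[where c = c]; use bd in simp)+
      (rule J.P.integrable_of_bounded[where c = "c * c"]; use bdm in simp)
  have meas: "(\<lambda>y. U (x(i:=y))) \<in> borel_measurable (N i)"
    "(\<lambda>y. V (x(i:=y))) \<in> borel_measurable (N i)" if "x \<in> space (PiM I N)" for x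
    by (rule measurable_section[OF insert.prems(1) that] measurable_section[OF insert.prems(2) that])+
  have bd_sec: "\<bar>U (x(i:=y))\<bar> \<le> c" "\<bar>V (x(i:=y))\<bar> \<le> c" "\<bar>U (x(i:=y)) * V (x(i:=y))\<bar> \<le> c * c"
    if "x \<in> space (PiM I N)" "y \<in> space (N i)" for x y
    by (rule bd bdm, rule fun_upd_in_space_PiM[OF that])+
  have sec: "integrable (N i) (\<lambda>y. U (x(i:=y)))" "integrable (N i) (\<lambda>y. V (x(i:=y)))"
    "integrable (N i) (\<lambda>y. U (x(i:=y)) * V (x(i:=y)))" if x: "x \<in> space (PiM I N)" for x
    by (rule M.integrable_of_bounded[OF meas(1)[OF x] bd_sec(1)[OF x]]
        M.integrable_of_bounded[OF meas(2)[OF x] bd_sec(2)[OF x]]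
        M.integrable_of_bounded[OF borel_measurable_times[OF meas[OF x]] bd_sec(3)[OF x]]; assumption)+
  define U' where "U' x = (\<integral>y. U (x(i:=y)) \<partial>N i)" for x
  define V' where "V' x = (\<integral>y. V (x(i:=y)) \<partial>N i)" for x
  have bd': "\<bar>U' x\<bar> \<le> c" "\<bar>V' x\<bar> \<le> c" if x: "x \<in> space (PiM I N)" for x
    unfolding U'_def V'_def
    by (rule M.abs_expectation_le[OF meas(1)[OF x] bd_sec(1)[OF x]]
        M.abs_expectation_le[OF meas(2)[OF x] bd_sec(2)[OF x]]; assumption)+
  have meas': "U' \<in> borel_measurable (PiM I N)" "V' \<in> borel_measurable (PiM I N)"
    unfolding U'_def V'_def
    by (rule measurable_partial_expectation[OF prob insert.prems(1)]
        measurable_partial_expectation[OF prob insert.prems(2)])+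
  have bdm': "\<bar>U' x * V' x\<bar> \<le> c * c" if "x \<in> space (PiM I N)" for x
    using bd'[OF that] c by (simp add: abs_mult mult_mono)
  have cm': "countermonotone_in N I k U' V'" if k: "k \<in> I" for k
    unfolding countermonotone_in_def
  proof (intro ballI)
    fix x x' s t
    assume *: "x \<in> space (PiM I N)" "x' \<in> space (PiM I N)" "s \<in> space (N k)" "t \<in> space (N k)"
    have ki: "k \<noteq> i" using k insert.hyps by auto
    have upd: "z(k:=r) \<in> space (PiM I N)" if "z \<in> space (PiM I N)" "r \<in> space (N k)" for z r
      using fun_upd_in_space_PiM[OF that] k by (simp add: insert_absorb)
    have "(\<integral>y. U (x(k:=s, i:=y)) - U (x(k:=t, i:=y)) \<partial>N i) *
          (\<integral>y. V (x'(k:=s, i:=y)) - V (x'(k:=t, i:=y)) \<partial>N i) \<le> 0"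
    proof (rule M.expectation_mult_nonpos)
      fix y z assume yz: "y \<in> space (N i)" "z \<in> space (N i)"
      show "(U (x(k:=s, i:=y)) - U (x(k:=t, i:=y))) * (V (x'(k:=s, i:=z)) - V (x'(k:=t, i:=z))) \<le> 0"
        unfolding fun_upd_twist[OF ki]
        by (rule countermonotone_inD[OF insert.prems(5)])
          (use k * yz in \<open>blast intro: fun_upd_in_space_PiM\<close>)+
    qed (intro Bochner_Integration.integrable_diff sec upd *)+
    then show "(U' (x(k:=s)) - U' (x(k:=t))) * (V' (x'(k:=s)) - V' (x'(k:=t))) \<le> 0"
      using * upd sec unfolding U'_def V'_def by simp
  qed
  have "(\<integral>x. U x * V x \<partial>PiM (insert i I) N)
      = (\<integral>x. (\<integral>y. U (x(i:=y)) * V (x(i:=y)) \<partial>N i) \<partial>PiM I N)"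
    by (rule product_integral_insert) (use insert.hyps int in auto)
  also have "\<dots> \<le> (\<integral>x. U' x * V' x \<partial>PiM I N)"
  proof (rule integral_mono)
    show "integrable (PiM I N) (\<lambda>x. \<integral>y. U (x(i:=y)) * V (x(i:=y)) \<partial>N i)"
    proof (rule P.integrable_of_bounded)
      show "\<bar>\<integral>y. U (x(i:=y)) * V (x(i:=y)) \<partial>N i\<bar> \<le> c * c" if x: "x \<in> space (PiM I N)" for x
        by (rule M.abs_expectation_le[OF borel_measurable_times[OF meas[OF x]] bd_sec(3)[OF x]])
      show "(\<lambda>x. \<integral>y. U (x(i:=y)) * V (x(i:=y)) \<partial>N i) \<in> borel_measurable (PiM I N)"
        by (rule measurable_partial_expectation[OF prob borel_measurable_times[OF insert.prems(1,2)]])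
    qed
    show "integrable (PiM I N) (\<lambda>x. U' x * V' x)"
      by (rule P.integrable_of_bounded[where c = "c * c"]) (use meas' bdm' in simp_all)
    fix x assume x: "x \<in> space (PiM I N)"
    show "(\<integral>y. U (x(i:=y)) * V (x(i:=y)) \<partial>N i) \<le> U' x * V' x"
      unfolding U'_def V'_def
    proof (rule M.chebyshev_negative_correlation)
      fix s t assume st: "s \<in> space (N i)" "t \<in> space (N i)"
      show "(U (x(i:=s)) - U (x(i:=t))) * (V (x(i:=s)) - V (x(i:=t))) \<le> 0"
      proof -
        \<comment> \<open>The base point must carry a value at \<^term>\<open>i\<close>, which the update then overwrites.\<close>
        have "(U (x(i:=s, i:=s)) - U (x(i:=s, i:=t))) * (V (x(i:=s, i:=s)) - V (x(i:=s, i:=t))) \<le> 0"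
          by (rule countermonotone_inD[OF insert.prems(5)])
            (use x st in \<open>blast intro: fun_upd_in_space_PiM\<close>)+
        then show ?thesis by simp
      qed
    qed (use sec[OF x] in auto)
  qed
  also have "\<dots> \<le> (\<integral>x. U' x \<partial>PiM I N) * (\<integral>x. V' x \<partial>PiM I N)"
    by (rule insert.IH) (use meas' bd' cm' in auto)
  also have "\<dots> = (\<integral>x. U x \<partial>PiM (insert i I) N) * (\<integral>x. V x \<partial>PiM (insert i I) N)"
    unfolding U'_def V'_def using insert.hyps int by (simp add: product_integral_insert)
  finally show ?case .
qed

definition clamp_real :: "real \<Rightarrow> real \<Rightarrow> real" where
  "clamp_real c x = max (- c) (min c x)"

lemma mono_clamp_real: "mono (clamp_real c)"
  by (auto simp: mono_def clamp_real_def)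

lemma abs_clamp_real_le: "0 \<le> c \<Longrightarrow> \<bar>clamp_real c x\<bar> \<le> c"
  by (auto simp: clamp_real_def)

lemma abs_clamp_real_le_abs: "0 \<le> c \<Longrightarrow> \<bar>clamp_real c x\<bar> \<le> \<bar>x\<bar>"
  by (auto simp: clamp_real_def)

lemma clamp_real_tendsto: "(\<lambda>k. clamp_real (real k) x) \<longlonglongrightarrow> x"
proof (rule tendsto_eventually)
  obtain k0 where "\<bar>x\<bar> \<le> real k0" using real_arch_simple by blast
  then show "\<forall>\<^sub>F k in sequentially. clamp_real (real k) x = x"
    by (intro eventually_sequentiallyI[of k0]) (auto simp: clamp_real_def)
qed

text \<open>
  Truncation at level \<open>k\<close> keeps the functions countermonotone, and \<open>U\<close>, \<open>V\<close> and \<open>U * V\<close> dominate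
  their truncated versions. Their integrability therefore justifies dominated convergence in all
  three integrals.
\<close>

lemma PiM_negative_correlation:
  fixes U V :: "('i \<Rightarrow> 'b) \<Rightarrow> real"
  assumes prob: "\<And>i. prob_space (N i)" and fin: "finite I"
    and int: "integrable (PiM I N) U" "integrable (PiM I N) V" "integrable (PiM I N) (\<lambda>x. U x * V x)"
    and cm: "\<And>i. i \<in> I \<Longrightarrow> countermonotone_in N I i U V"
  shows "(\<integral>x. U x * V x \<partial>PiM I N) \<le> (\<integral>x. U x \<partial>PiM I N) * (\<integral>x. V x \<partial>PiM I N)"
proof (rule LIMSEQ_le)
  let ?T = "\<lambda>k. clamp_real (real k)"
  have [measurable]: "U \<in> borel_measurable (PiM I N)" "V \<in> borel_measurable (PiM I N)"
    using int by auto
  have [measurable]: "?T k \<in> borel_measurable borel" for k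
    by (intro borel_measurable_mono mono_clamp_real)
  show "(\<lambda>k. \<integral>x. ?T k (U x) * ?T k (V x) \<partial>PiM I N) \<longlonglongrightarrow> (\<integral>x. U x * V x \<partial>PiM I N)"
  proof (rule integral_dominated_convergence[where w = "\<lambda>x. \<bar>U x * V x\<bar>"])
    show "integrable (PiM I N) (\<lambda>x. \<bar>U x * V x\<bar>)"
      using int(3) by (rule integrable_abs)
    show "AE x in PiM I N. (\<lambda>k. ?T k (U x) * ?T k (V x)) \<longlonglongrightarrow> U x * V x"
      by (intro AE_I2 tendsto_mult clamp_real_tendsto)
    show "AE x in PiM I N. norm (?T k (U x) * ?T k (V x)) \<le> \<bar>U x * V x\<bar>" for k
      by (intro AE_I2) (simp add: abs_mult mult_mono abs_clamp_real_le_abs)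
  qed auto
  show "(\<lambda>k. (\<integral>x. ?T k (U x) \<partial>PiM I N) * (\<integral>x. ?T k (V x) \<partial>PiM I N))
      \<longlonglongrightarrow> (\<integral>x. U x \<partial>PiM I N) * (\<integral>x. V x \<partial>PiM I N)"
  proof (rule tendsto_mult)
    show "(\<lambda>k. \<integral>x. ?T k (U x) \<partial>PiM I N) \<longlonglongrightarrow> (\<integral>x. U x \<partial>PiM I N)"
      using int(1) by (intro integral_dominated_convergence[where w = "\<lambda>x. \<bar>U x\<bar>"])
        (auto intro!: AE_I2 clamp_real_tendsto simp: abs_clamp_real_le_abs)
    show "(\<lambda>k. \<integral>x. ?T k (V x) \<partial>PiM I N) \<longlonglongrightarrow> (\<integral>x. V x \<partial>PiM I N)"
      using int(2) by (intro integral_dominated_convergence[where w = "\<lambda>x. \<bar>V x\<bar>"])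
        (auto intro!: AE_I2 clamp_real_tendsto simp: abs_clamp_real_le_abs)
  qed
  have "(\<integral>x. ?T k (U x) * ?T k (V x) \<partial>PiM I N)
      \<le> (\<integral>x. ?T k (U x) \<partial>PiM I N) * (\<integral>x. ?T k (V x) \<partial>PiM I N)" for k
  proof (rule PiM_negative_correlation_bounded[OF prob fin])
    show "countermonotone_in N I i (\<lambda>x. ?T k (U x)) (\<lambda>x. ?T k (V x))" if "i \<in> I" for i
      by (rule countermonotone_in_mono_comp[OF mono_clamp_real mono_clamp_real cm[OF that]])
    show "\<bar>?T k (U x)\<bar> \<le> real k" "\<bar>?T k (V x)\<bar> \<le> real k" for x
      by (simp_all add: abs_clamp_real_le)
  qed simp_all
  then show "\<exists>k0. \<forall>k\<ge>k0. (\<integral>x. ?T k (U x) * ?T k (V x) \<partial>PiM I N)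
      \<le> (\<integral>x. ?T k (U x) \<partial>PiM I N) * (\<integral>x. ?T k (V x) \<partial>PiM I N)"
    by blast
qed

section \<open>Independent random variables\<close>

lemma (in prob_space) covariance_eq_expectations:
  assumes "covariance_exists M U V"
  shows "covariance M U V = expectation (\<lambda>\<omega>. U \<omega> * V \<omega>) - expectation U * expectation V"
proof -
  have [simp]: "integrable M U" "integrable M V" "integrable M (\<lambda>\<omega>. U \<omega> * V \<omega>)"
    using assms by (auto simp: covariance_exists_def)
  have "covariance M U V = (\<integral>\<omega>. U \<omega> * V \<omega> - U \<omega> * expectation V - expectation U * V \<omega>
      + expectation U * expectation V \<partial>M)"
    unfolding covariance_def by (rule Bochner_Integration.integral_cong) (auto simp: algebra_simps)
  then show ?thesis by (simp add: prob_space)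
qed

text \<open>
  Independence says that the joint distribution of the \<open>X i\<close> is the product of their marginals, so
  that the covariance can be computed under a product measure.
\<close>

lemma (in prob_space) indep_vars_covariance_nonpos:
  fixes X :: "'i \<Rightarrow> 'a \<Rightarrow> real" and u v :: "('i \<Rightarrow> real) \<Rightarrow> real"
  assumes indep: "indep_vars (\<lambda>_. borel) X I" and fin: "finite I"
    and meas: "u \<in> borel_measurable (PiM I (\<lambda>_. borel))" "v \<in> borel_measurable (PiM I (\<lambda>_. borel))"
    and cm: "\<And>i. i \<in> I \<Longrightarrow> countermonotone_in (\<lambda>_. borel) I i u v"
    and ex: "covariance_exists M (\<lambda>\<omega>. u (\<lambda>i\<in>I. X i \<omega>)) (\<lambda>\<omega>. v (\<lambda>i\<in>I. X i \<omega>))"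
  shows "covariance M (\<lambda>\<omega>. u (\<lambda>i\<in>I. X i \<omega>)) (\<lambda>\<omega>. v (\<lambda>i\<in>I. X i \<omega>)) \<le> 0"
proof (cases "I = {}")
  case True
  \<comment> \<open>Both functions are then constant on \<^term>\<open>M\<close>.\<close>
  have "(\<lambda>i\<in>I. X i \<omega>) = (\<lambda>_. undefined)" for \<omega>
    using True by auto
  then show ?thesis by (simp add: covariance_def prob_space)
next
  case False
  have rv: "random_variable borel (X i)" if "i \<in> I" for i
    using indep that by (auto simp: indep_vars_def)
  \<comment> \<open>Outside \<^term>\<open>I\<close> any probability measure will do; the constant variable 0 supplies one.\<close>
  define N where "N i = distr M borel (if i \<in> I then X i else (\<lambda>_. 0))" for i
  have prob: "prob_space (N i)" for i
    unfolding N_def using rv by (intro prob_space_distr) auto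
  have setsN: "sets (PiM I N) = sets (PiM I (\<lambda>_. borel))"
    by (intro sets_PiM_cong) (auto simp: N_def)
  let ?P = "PiM I (\<lambda>_. borel) :: ('i \<Rightarrow> real) measure"
  let ?X = "\<lambda>\<omega>. \<lambda>i\<in>I. X i \<omega>"
  have X: "?X \<in> measurable M ?P"
    using rv by (intro measurable_restrict) auto
  have distr: "distr M ?P ?X = PiM I N"
    using indep_vars_iff_distr_eq_PiM'[of I X "\<lambda>_. borel"] False rv indep
    by (auto simp: N_def intro!: PiM_cong)
  have meas_mult: "(\<lambda>x. u x * v x) \<in> borel_measurable ?P"
    using meas by simp
  have int: "integrable (PiM I N) u" "integrable (PiM I N) v" "integrable (PiM I N) (\<lambda>x. u x * v x)"
    using ex meas meas_mult unfolding distr[symmetric] covariance_exists_def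
    by (simp_all add: integrable_distr_eq[OF X])
  have cmN: "countermonotone_in N I i u v" if "i \<in> I" for i
    using cm[OF that] sets_eq_imp_space_eq[OF setsN] by (simp add: countermonotone_in_def N_def)
  have "(\<integral>x. u x * v x \<partial>PiM I N) \<le> (\<integral>x. u x \<partial>PiM I N) * (\<integral>x. v x \<partial>PiM I N)"
    by (rule PiM_negative_correlation[OF prob fin int cmN])
  then have "expectation (\<lambda>\<omega>. u (?X \<omega>) * v (?X \<omega>))
      \<le> expectation (\<lambda>\<omega>. u (?X \<omega>)) * expectation (\<lambda>\<omega>. v (?X \<omega>))"
    unfolding distr[symmetric]
    by (simp add: integral_distr[OF X] meas meas_mult)
  then show ?thesis
    using covariance_eq_expectations[OF ex] by simp
qed

section \<open>Increasing functions of the scores\<close>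

text \<open>
  Passing from \<^term>\<open>x\<close> to \<^term>\<open>y\<close> one coordinate at a time turns monotonicity in each coordinate
  into monotonicity for the product order.
\<close>

lemma coordwise_increasing_le:
  assumes fin: "finite I" and inc: "coordwise_increasing I f"
    and xy: "x \<in> (\<Pi>\<^sub>E i\<in>I. UNIV)" "y \<in> (\<Pi>\<^sub>E i\<in>I. UNIV)" "\<And>i. i \<in> I \<Longrightarrow> x i \<le> y i"
  shows "f x \<le> f y"
proof -
  let ?h = "\<lambda>K i. if i \<in> K then y i else x i"
  have "K \<subseteq> I \<Longrightarrow> f x \<le> f (?h K)" if "finite K" for K
    using that
  proof (induction K rule: finite_induct)
    case empty
    then show ?case by simp
  next
    case (insert k K)
    have "?h K \<in> (\<Pi>\<^sub>E i\<in>I. UNIV)"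
      using xy(1,2) by (auto simp: PiE_def extensional_def)
    then have "mono (\<lambda>t. f ((?h K)(k:=t)))"
      using inc insert.prems unfolding coordwise_increasing_def by blast
    then have "f ((?h K)(k:=x k)) \<le> f ((?h K)(k:=y k))"
      by (rule monoD) (use xy(3) insert.prems in auto)
    moreover have "(?h K)(k:=x k) = ?h K" "(?h K)(k:=y k) = ?h (insert k K)"
      using insert.hyps by auto
    ultimately show ?case using insert by simp
  qed
  from this[OF fin] have "f x \<le> f (?h I)" by simp
  also have "?h I = y"
    using xy(1,2) by (auto simp: PiE_def extensional_def)
  finally show ?thesis .
qed

text \<open>
  The decreasing transforms are absorbed into the score, which makes it a function of a single point
  \<^term>\<open>x\<close>, in which one variable may be read through both kinds of block.
\<close>

definition score ::
    "('j \<Rightarrow> 'i set) \<Rightarrow> ('j \<Rightarrow> 'i set) \<Rightarrow> ('i \<Rightarrow> real \<Rightarrow> real) \<Rightarrow> ('j \<Rightarrow> ('i + 'i \<Rightarrow> real) \<Rightarrow> real) \<Rightarrow>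
      'j \<Rightarrow> ('i \<Rightarrow> real) \<Rightarrow> real" where
  "score A B g f j x = f j (\<lambda>k\<in>A j <+> B j. case k of Inl i \<Rightarrow> x i | Inr i \<Rightarrow> g i (x i))"

lemma measurable_score:
  assumes "A j \<subseteq> I" "B j \<subseteq> I" "\<And>i. i \<in> I \<Longrightarrow> antimono (g i)"
    and "f j \<in> borel_measurable (PiM (A j <+> B j) (\<lambda>_. borel))"
  shows "score A B g f j \<in> borel_measurable (PiM I (\<lambda>_. borel))"
proof -
  have g: "g i \<in> borel_measurable borel" if "i \<in> I" for i
  proof -
    have "mono (\<lambda>t. - g i t)"
      using assms(3)[OF that] by (auto simp: mono_def antimono_def)
    then show ?thesis
      using borel_measurable_mono by fastforce
  qed
  have "(\<lambda>x. \<lambda>k\<in>A j <+> B j. case k of Inl i \<Rightarrow> x i | Inr i \<Rightarrow> g i (x i))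
      \<in> measurable (PiM I (\<lambda>_. borel)) (PiM (A j <+> B j) (\<lambda>_. borel))"
  proof (rule measurable_restrict)
    fix k assume "k \<in> A j <+> B j"
    then show "(\<lambda>x. case k of Inl i \<Rightarrow> x i | Inr i \<Rightarrow> g i (x i)) \<in> borel_measurable (PiM I (\<lambda>_. borel))"
      using assms(1,2) by (auto intro!: measurable_component_singleton measurable_compose[OF _ g])
  qed
  from measurable_compose[OF this assms(4)] show ?thesis
    by (simp add: score_def[abs_def])
qed

lemma score_restrict:
  assumes "A j \<subseteq> I" "B j \<subseteq> I"
  shows "score A B g f j (restrict x I) = score A B g f j x"
  unfolding score_def using assms
  by (intro arg_cong[of _ _ "f j"] restrict_ext) auto

text \<open>
  A function of scores rises when the variables read through the blocks \<open>A j\<close> rise and those read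
  through the blocks \<open>B j\<close>, where \<open>g\<close> reverses the order, fall. A variable that
  is read through one kind of block only may therefore be moved alone.
\<close>

lemma increasing_of_scores_le:
  assumes "finite J" "coordwise_increasing J F"
    and "\<And>j. j \<in> J \<Longrightarrow> finite (A j)" "\<And>j. j \<in> J \<Longrightarrow> finite (B j)"
    and "\<And>j. j \<in> J \<Longrightarrow> coordwise_increasing (A j <+> B j) (f j)"
    and "\<And>j i. j \<in> J \<Longrightarrow> i \<in> B j \<Longrightarrow> antimono (g i)"
    and "\<And>j i. j \<in> J \<Longrightarrow> i \<in> A j \<Longrightarrow> x i \<le> y i" "\<And>j i. j \<in> J \<Longrightarrow> i \<in> B j \<Longrightarrow> y i \<le> x i"
  shows "F (\<lambda>j\<in>J. score A B g f j x) \<le> F (\<lambda>j\<in>J. score A B g f j y)"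
proof (rule coordwise_increasing_le[OF assms(1,2)])
  fix j assume j: "j \<in> J"
  have "score A B g f j x \<le> score A B g f j y"
    unfolding score_def
  proof (rule coordwise_increasing_le[OF _ assms(5)[OF j]])
    fix k assume "k \<in> A j <+> B j"
    then show "(\<lambda>k\<in>A j <+> B j. case k of Inl i \<Rightarrow> x i | Inr i \<Rightarrow> g i (x i)) k
        \<le> (\<lambda>k\<in>A j <+> B j. case k of Inl i \<Rightarrow> y i | Inr i \<Rightarrow> g i (y i)) k"
      using assms(7)[OF j] antimonoD[OF assms(6)[OF j] assms(8)[OF j]] by auto
  qed (use assms(3,4) j in auto)
  then show "(\<lambda>j\<in>J. score A B g f j x) j \<le> (\<lambda>j\<in>J. score A B g f j y) j"
    using j by simp
qed auto

text \<open>
  Disjointness of the blocks enters here, once for the \<open>A j\<close> and once for the \<open>B j\<close>: it leaves at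
  least one of the two functions decreasing in \<^term>\<open>i\<close>, and at least one of them increasing. If
  both descriptions fit the same function, that function does not depend on \<^term>\<open>i\<close>.
\<close>

lemma countermonotone_in_scores:
  assumes J: "finite J" "finite J'" "J \<inter> J' = {}"
    and F: "coordwise_increasing J F" "coordwise_increasing J' F'"
    and fin: "\<And>j. j \<in> J \<union> J' \<Longrightarrow> finite (A j)" "\<And>j. j \<in> J \<union> J' \<Longrightarrow> finite (B j)"
    and disj: "disjoint_family_on A (J \<union> J')" "disjoint_family_on B (J \<union> J')"
    and f: "\<And>j. j \<in> J \<union> J' \<Longrightarrow> coordwise_increasing (A j <+> B j) (f j)"
    and g: "\<And>j i. j \<in> J \<union> J' \<Longrightarrow> i \<in> B j \<Longrightarrow> antimono (g i)"
  shows "countermonotone_in N I i (\<lambda>x. F (\<lambda>j\<in>J. score A B g f j x)) (\<lambda>x. F' (\<lambda>j\<in>J'. score A B g f j x))"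
proof -
  let ?U = "\<lambda>x. F (\<lambda>j\<in>J. score A B g f j x)"
  let ?V = "\<lambda>x. F' (\<lambda>j\<in>J'. score A B g f j x)"
  have leU: "?U x \<le> ?U y" if xy: "\<And>j k. j \<in> J \<Longrightarrow> k \<in> A j \<Longrightarrow> x k \<le> y k"
    "\<And>j k. j \<in> J \<Longrightarrow> k \<in> B j \<Longrightarrow> y k \<le> x k" for x y
  proof (rule increasing_of_scores_le[OF J(1) F(1)])
    show "antimono (g i)" if "j \<in> J" "i \<in> B j" for j i
      using that by (intro g[of j]) auto
  qed (use fin f xy in auto)
  have leV: "?V x \<le> ?V y" if xy: "\<And>j k. j \<in> J' \<Longrightarrow> k \<in> A j \<Longrightarrow> x k \<le> y k"
    "\<And>j k. j \<in> J' \<Longrightarrow> k \<in> B j \<Longrightarrow> y k \<le> x k" for x y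
  proof (rule increasing_of_scores_le[OF J(2) F(2)])
    show "antimono (g i)" if "j \<in> J'" "i \<in> B j" for j i
      using that by (intro g[of j]) auto
  qed (use fin f xy in auto)
  have only_one: "(\<forall>j\<in>J. i \<notin> C j) \<or> (\<forall>j\<in>J'. i \<notin> C j)" if "disjoint_family_on C (J \<union> J')" for C
  proof (rule ccontr)
    assume "\<not> ?thesis"
    then obtain j j' where "j \<in> J" "j' \<in> J'" "i \<in> C j" "i \<in> C j'" by auto
    moreover from this have "j \<noteq> j'" using J(3) by auto
    ultimately show False using disjoint_family_onD[OF that, of j j'] by auto
  qed
  have *: "(?U (x(i:=s)) - ?U (x(i:=t))) * (?V (x'(i:=s)) - ?V (x'(i:=t))) \<le> 0"
    if st: "s \<le> t" for x x' s t
  proof -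
    have "(\<forall>j\<in>J. i \<notin> A j) \<or> (\<forall>j\<in>J'. i \<notin> A j)"
      using only_one[OF disj(1)] .
    then have dec: "?U (x(i:=t)) \<le> ?U (x(i:=s)) \<or> ?V (x'(i:=t)) \<le> ?V (x'(i:=s))"
    proof
      assume "\<forall>j\<in>J. i \<notin> A j"
      then have "?U (x(i:=t)) \<le> ?U (x(i:=s))" by (intro leU) (use st in auto)
      then show ?thesis ..
    next
      assume "\<forall>j\<in>J'. i \<notin> A j"
      then have "?V (x'(i:=t)) \<le> ?V (x'(i:=s))" by (intro leV) (use st in auto)
      then show ?thesis ..
    qed
    have "(\<forall>j\<in>J. i \<notin> B j) \<or> (\<forall>j\<in>J'. i \<notin> B j)"
      using only_one[OF disj(2)] .
    then have inc: "?U (x(i:=s)) \<le> ?U (x(i:=t)) \<or> ?V (x'(i:=s)) \<le> ?V (x'(i:=t))"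
    proof
      assume "\<forall>j\<in>J. i \<notin> B j"
      then have "?U (x(i:=s)) \<le> ?U (x(i:=t))" by (intro leU) (use st in auto)
      then show ?thesis ..
    next
      assume "\<forall>j\<in>J'. i \<notin> B j"
      then have "?V (x'(i:=s)) \<le> ?V (x'(i:=t))" by (intro leV) (use st in auto)
      then show ?thesis ..
    qed
    have "(a - b) * (c - d) \<le> 0" if "b \<le> a \<or> d \<le> c" "a \<le> b \<or> c \<le> d" for a b c d :: real
      using that by (auto simp: mult_le_0_iff)
    from this[OF dec inc] show ?thesis .
  qed
  show ?thesis
    unfolding countermonotone_in_def
  proof (intro ballI)
    fix x x' s t
    show "(?U (x(i:=s)) - ?U (x(i:=t))) * (?V (x'(i:=s)) - ?V (x'(i:=t))) \<le> 0"
      \<comment> \<open>Exchanging \<^term>\<open>s\<close> and \<^term>\<open>t\<close> changes both signs.\<close>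
      using *[of s t x x'] *[of t s x x'] by (cases "s \<le> t") (auto simp: algebra_simps)
  qed
qed


theorem theorem2p1:
  fixes M :: "'a measure"
    and n m :: nat
    and X Y S :: "nat \<Rightarrow> 'a \<Rightarrow> real"
    and g :: "nat \<Rightarrow> real \<Rightarrow> real"
    and A B :: "nat \<Rightarrow> nat set"
    and f :: "nat \<Rightarrow> (nat + nat \<Rightarrow> real) \<Rightarrow> real"
  assumes "prob_space M"
    and "prob_space.indep_vars M (\<lambda>_. borel) X {1..n}"
    and "\<And>i. i \<in> {1..n} \<Longrightarrow> antimono (g i)"
    and "\<And>i \<omega>. i \<in> {1..n} \<Longrightarrow> \<omega> \<in> space M \<Longrightarrow> Y i \<omega> = g i (X i \<omega>)"
    and "\<And>j. j \<in> {1..m} \<Longrightarrow> A j \<subseteq> {1..n}"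
    and "disjoint_family_on A {1..m}"
    and "\<And>j. j \<in> {1..m} \<Longrightarrow> B j \<subseteq> {1..n}"
    and "disjoint_family_on B {1..m}"
    and "\<And>j. j \<in> {1..m} \<Longrightarrow> f j \<in> borel_measurable (PiM (A j <+> B j) (\<lambda>_. borel))"
    and "\<And>j. j \<in> {1..m} \<Longrightarrow> coordwise_increasing (A j <+> B j) (f j)"
    and "\<And>j \<omega>. j \<in> {1..m} \<Longrightarrow> \<omega> \<in> space M \<Longrightarrow>
           S j \<omega> = f j (\<lambda>k \<in> A j <+> B j. case k of Inl i \<Rightarrow> X i \<omega> | Inr i \<Rightarrow> Y i \<omega>)"
  shows "negatively_associated M {1..m} S"
proof -
  interpret prob_space M by fact
  let ?P = "PiM {1..n} (\<lambda>_. borel) :: (nat \<Rightarrow> real) measure"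
  let ?X = "\<lambda>\<omega>. \<lambda>i\<in>{1..n}. X i \<omega>"
  let ?s = "score A B g f"
  have rv: "random_variable borel (X i)" if "i \<in> {1..n}" for i
    using assms(2) that by (auto simp: indep_vars_def)
  have X: "?X \<in> measurable M ?P"
    using rv by (intro measurable_restrict) auto
  have S: "S j \<omega> = ?s j (?X \<omega>)" if j: "j \<in> {1..m}" and \<omega>: "\<omega> \<in> space M" for j \<omega>
  proof -
    have "S j \<omega> = ?s j (\<lambda>i. X i \<omega>)"
      unfolding assms(11)[OF j \<omega>] score_def using assms(4)[OF _ \<omega>] assms(7)[OF j]
      by (intro arg_cong[of _ _ "f j"] restrict_ext) auto
    also have "\<dots> = ?s j (?X \<omega>)"
      using assms(5,7)[OF j] by (simp only: score_restrict)
    finally show ?thesis .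
  qed
  have meas_s: "?s j \<in> borel_measurable ?P" if "j \<in> {1..m}" for j
    using assms(3,5,7,9) that by (intro measurable_score) auto
  have fin: "finite (A j)" "finite (B j)" if "j \<in> {1..m}" for j
    using assms(5,7)[OF that] by (auto intro: finite_subset)
  show ?thesis
    unfolding negatively_associated_def
  proof (intro conjI ballI allI impI)
    fix j assume j: "j \<in> {1..m}"
    have "(\<lambda>\<omega>. ?s j (?X \<omega>)) \<in> borel_measurable M"
      by (rule measurable_compose[OF X meas_s[OF j]])
    then show "S j \<in> borel_measurable M"
      using S[OF j] by (simp cong: measurable_cong)
  next
    fix J J' F F'
    assume J: "J \<subseteq> {1..m}" "J' \<subseteq> {1..m}" "J \<inter> J' = {}"
      and F: "F \<in> borel_measurable (PiM J (\<lambda>_. borel))" "coordwise_increasing J F"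
      and F': "F' \<in> borel_measurable (PiM J' (\<lambda>_. borel))" "coordwise_increasing J' F'"
      and ex: "covariance_exists M (\<lambda>\<omega>. F (\<lambda>i\<in>J. S i \<omega>)) (\<lambda>\<omega>. F' (\<lambda>i\<in>J'. S i \<omega>))"
    let ?U = "\<lambda>x. F (\<lambda>j\<in>J. ?s j x)" and ?V = "\<lambda>x. F' (\<lambda>j\<in>J'. ?s j x)"
    have SU: "F (\<lambda>i\<in>J. S i \<omega>) = ?U (?X \<omega>)" and SV: "F' (\<lambda>i\<in>J'. S i \<omega>) = ?V (?X \<omega>)"
      if "\<omega> \<in> space M" for \<omega>
    proof -
      have "(\<lambda>i\<in>J. S i \<omega>) = (\<lambda>j\<in>J. ?s j (?X \<omega>))" "(\<lambda>i\<in>J'. S i \<omega>) = (\<lambda>j\<in>J'. ?s j (?X \<omega>))"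
        using S[OF _ that] J(1,2) by (blast intro: restrict_ext)+
      then show "F (\<lambda>i\<in>J. S i \<omega>) = ?U (?X \<omega>)" "F' (\<lambda>i\<in>J'. S i \<omega>) = ?V (?X \<omega>)"
        by simp_all
    qed
    have "finite J" "finite J'"
      using J(1,2) by (auto intro: finite_subset)
    moreover have "disjoint_family_on A (J \<union> J')" "disjoint_family_on B (J \<union> J')"
      by (rule disjoint_family_on_mono[OF Un_least[OF J(1,2)]], fact)+
    moreover have "antimono (g i)" if "j \<in> J \<union> J'" "i \<in> B j" for i j
      using that J(1,2) assms(3,7) by blast
    ultimately have cm: "countermonotone_in (\<lambda>_. borel) {1..n} i ?U ?V" for i
      using J F(2) F'(2) fin assms(10) by (intro countermonotone_in_scores) blast+
    have meas: "?U \<in> borel_measurable ?P" "?V \<in> borel_measurable ?P"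
      by (rule measurable_compose[OF measurable_restrict F(1)]
          measurable_compose[OF measurable_restrict F'(1)], use meas_s J(1,2) in blast)+
    have "covariance_exists M (\<lambda>\<omega>. ?U (?X \<omega>)) (\<lambda>\<omega>. ?V (?X \<omega>))"
    proof -
      have "integrable M (\<lambda>\<omega>. F (\<lambda>i\<in>J. S i \<omega>)) \<longleftrightarrow> integrable M (\<lambda>\<omega>. ?U (?X \<omega>))"
        "integrable M (\<lambda>\<omega>. F' (\<lambda>i\<in>J'. S i \<omega>)) \<longleftrightarrow> integrable M (\<lambda>\<omega>. ?V (?X \<omega>))"
        "integrable M (\<lambda>\<omega>. F (\<lambda>i\<in>J. S i \<omega>) * F' (\<lambda>i\<in>J'. S i \<omega>))
          \<longleftrightarrow> integrable M (\<lambda>\<omega>. ?U (?X \<omega>) * ?V (?X \<omega>))"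
        by (intro Bochner_Integration.integrable_cong refl arg_cong2[of _ _ _ _ "(*)"] SU SV; assumption)+
      with ex show ?thesis unfolding covariance_exists_def by blast
    qed
    from indep_vars_covariance_nonpos[OF assms(2) _ meas cm this]
    have neg: "covariance M (\<lambda>\<omega>. ?U (?X \<omega>)) (\<lambda>\<omega>. ?V (?X \<omega>)) \<le> 0"
      by (simp only: finite_atLeastAtMost simp_thms)
    show "covariance M (\<lambda>\<omega>. F (\<lambda>i\<in>J. S i \<omega>)) (\<lambda>\<omega>. F' (\<lambda>i\<in>J'. S i \<omega>)) \<le> 0"
    proof -
      have "expectation (\<lambda>\<omega>. F (\<lambda>i\<in>J. S i \<omega>)) = expectation (\<lambda>\<omega>. ?U (?X \<omega>))"
        by (rule Bochner_Integration.integral_cong[OF refl SU])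
      moreover have "expectation (\<lambda>\<omega>. F' (\<lambda>i\<in>J'. S i \<omega>)) = expectation (\<lambda>\<omega>. ?V (?X \<omega>))"
        by (rule Bochner_Integration.integral_cong[OF refl SV])
      ultimately have "covariance M (\<lambda>\<omega>. F (\<lambda>i\<in>J. S i \<omega>)) (\<lambda>\<omega>. F' (\<lambda>i\<in>J'. S i \<omega>))
          = covariance M (\<lambda>\<omega>. ?U (?X \<omega>)) (\<lambda>\<omega>. ?V (?X \<omega>))"
        unfolding covariance_def
        by (intro Bochner_Integration.integral_cong refl) (simp only: SU SV)
      with neg show ?thesis by (simp only:)
    qed
  qed
qed

end
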